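(* Let $\mathcal{L}$ be a Riesz space and $\mathcal{M}$ a Dedekind complete Riesz space. Let $(R_n)$ be a sequence in $\mathcal{L}_b(\mathcal{L},\mathcal{M})$ and $R_1^*,R_2^*\in\mathcal{L}_b(\mathcal{L},\mathcal{M})$. If $(R_n)$ is statistically order convergent to $R_1^*$ and statistically order convergent to $R_2^*$, then $R_1^*=R_2^*$.
   Context: All Riesz spaces (vector lattices) are real and Archimedean; $\theta$ denotes the zero element. "Operator" means linear map. An operator is order bounded if it maps order bounded sets to order bounded sets. $\mathcal{L}_b(\mathcal{L},\mathcal{M})$ is the space of order bounded operators $\mathcal{L}\to\mathcal{M}$, ordered by $S\le T$ iff $S(u)\le T(u)$ for all $u\in\mathcal{L}_+$. When $\mathcal{M}$ is Dedekind complete (every non-empty set bounded above has a supremum), $\mathcal{L}_b(\mathcal{L},\mathcal{M})$ is a Dedekind complete Riesz space; $|\cdot|$ is the modulus in it. The natural density of $J\subseteq\mathbb{N}$ is $\delta(J)=\lim_{n\to\infty}\frac1n|\{j\in J: j\le n\}|$, when the limit exists. A sequence $(S_n)$ in $\mathcal{L}_b(\mathcal{L},\mathcal{M})$ is statistically order decreasing to $S\in\mathcal{L}_b(\mathcal{L},\mathcal{M})$ if there is $J\subseteq\mathbb{N}$ with $\delta(J)=1$ such that $S_m\le S_j$ for all $j<m$ in $J$ and $\inf_{j\in J}S_j=S$ in $\mathcal{L}_b(\mathcal{L},\mathcal{M})$. A sequence $(R_n)$ in $\mathcal{L}_b(\mathcal{L},\mathcal{M})$ is statistically order convergent to $R\in\mathcal{L}_b(\mathcal{L},\mathcal{M})$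 if there exist a sequence $(S_n)$ in $\mathcal{L}_b(\mathcal{L},\mathcal{M})$ statistically order decreasing to $\theta$ and a set $J\subseteq\mathbb{N}$ with $\delta(J)=1$ such that $|R_j-R|\le S_j$ for all $j\in J$. *)

theory Defs
  imports Complex_Main "HOL-Library.Lattice_Algebras" "HOL-Library.Lub_Glb"
begin

section \<open>Riesz spaces\<close>

class riesz_space = ordered_real_vector + lattice_ab_group_add +
  assumes archimedean: "0 \<le> u \<Longrightarrow> 0 \<le> v \<Longrightarrow> (\<And>n::nat. of_nat n *\<^sub>R v \<le> u) \<Longrightarrow> v = 0"

text \<open>
  In \<^class>\<open>conditionally_complete_lattice\<close>, \<^const>\<open>Sup\<close> and \<^const>\<open>Inf\<close> are constrained only on
  nonempty order bounded sets, so the class says exactly that suprema of nonempty sets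
  bounded above (equivalently, infima of nonempty sets bounded below) exist.
\<close>

class dedekind_complete_riesz_space = riesz_space + conditionally_complete_lattice


section \<open>Order bounded operators\<close>

definition order_bounded :: "'a::order set \<Rightarrow> bool"
  where "order_bounded A \<longleftrightarrow> (\<exists>a b. A \<subseteq> {a..b})"

definition order_bounded_operator :: "('a::riesz_space \<Rightarrow> 'b::riesz_space) \<Rightarrow> bool"
  where "order_bounded_operator T \<longleftrightarrow>
    linear T \<and> (\<forall>A. order_bounded A \<longrightarrow> order_bounded (T ` A))"

lemma order_bounded_operatorI:
  fixes T :: "'a::riesz_space \<Rightarrow> 'b::riesz_space"
  assumes "linear T" "\<And>a b. \<exists>c d. \<forall>x. a \<le> x \<and> x \<le> b \<longrightarrow> c \<le> T x \<and> T x \<le> d"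
  shows "order_bounded_operator T"
  unfolding order_bounded_operator_def order_bounded_def
proof (intro conjI allI impI)
  fix A :: "'a set" assume "\<exists>a b. A \<subseteq> {a..b}"
  then obtain a b where ab: "A \<subseteq> {a..b}" by blast
  from assms(2)[of a b] obtain c d where "\<forall>x. a \<le> x \<and> x \<le> b \<longrightarrow> c \<le> T x \<and> T x \<le> d" by blast
  with ab have "T ` A \<subseteq> {c..d}" by auto
  then show "\<exists>c d. T ` A \<subseteq> {c..d}" by blast
qed (rule assms(1))

lemma order_bounded_operatorE:
  assumes "order_bounded_operator T"
  obtains c d where "\<And>x. a \<le> x \<Longrightarrow> x \<le> b \<Longrightarrow> c \<le> T x \<and> T x \<le> d"
proof -
  have "order_bounded {a..b}" unfolding order_bounded_def by blast
  then have "order_bounded (T ` {a..b})" using assms by (auto simp: order_bounded_operator_def)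
  then obtain c d where "T ` {a..b} \<subseteq> {c..d}" by (auto simp: order_bounded_def)
  then have "\<forall>x. a \<le> x \<and> x \<le> b \<longrightarrow> T x \<in> {c..d}" by (simp add: image_subset_iff)
  then show thesis by (intro that[of c d]) auto
qed

lemma order_bounded_operator_positive:
  assumes T: "linear T" and pos: "\<And>x. 0 \<le> x \<Longrightarrow> 0 \<le> T x"
  shows "order_bounded_operator T"
proof (rule order_bounded_operatorI[OF T])
  have "T x \<le> T y" if "x \<le> y" for x y
    using pos[of "y - x"] that by (simp add: linear_diff[OF T])
  then show "\<exists>c d. \<forall>x. a \<le> x \<and> x \<le> b \<longrightarrow> c \<le> T x \<and> T x \<le> d" for a b by blast
qed

typedef (overloaded) ('a::riesz_space, 'b::riesz_space) ob_operator =
  "{T :: 'a \<Rightarrow> 'b. order_bounded_operator T}"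
  morphisms ob_apply Ob_operator
proof
  have "linear (\<lambda>x::'a. 0::'b)" by (simp add: linear_iff)
  then show "(\<lambda>x. 0) \<in> {T :: 'a \<Rightarrow> 'b. order_bounded_operator T}"
    by (simp add: order_bounded_operator_positive)
qed

setup_lifting type_definition_ob_operator

lemma ob_operator_bounded: "order_bounded_operator (ob_apply T)"
  using ob_apply[of T] by simp

lemma ob_operator_linear: "linear (ob_apply T)"
  using ob_operator_bounded[of T] by (simp add: order_bounded_operator_def)

lemma ob_operator_cone_eqI:
  assumes "\<And>x. 0 \<le> x \<Longrightarrow> ob_apply S x = ob_apply T x"
  shows "S = T"
proof -
  have "ob_apply S x = ob_apply T x" for x
  proof -
    have x: "x = pprt x - pprt (- x)" using prts[of x] by (simp add: pprt_neg)
    show ?thesis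
      by (subst (1 2) x) (simp add: linear_diff[OF ob_operator_linear] assms)
  qed
  then show ?thesis by (simp add: ob_apply_inject[symmetric] fun_eq_iff)
qed

instantiation ob_operator :: (riesz_space, riesz_space) real_vector
begin

lift_definition zero_ob_operator :: "('a, 'b) ob_operator" is "\<lambda>x. 0"
  by (rule order_bounded_operator_positive) (simp_all add: linear_iff)

lift_definition plus_ob_operator ::
    "('a, 'b) ob_operator \<Rightarrow> ('a, 'b) ob_operator \<Rightarrow> ('a, 'b) ob_operator"
  is "\<lambda>S T x. S x + T x"
proof (rule order_bounded_operatorI)
  fix S T :: "'a \<Rightarrow> 'b" and a b
  assume S: "order_bounded_operator S" and T: "order_bounded_operator T"
  show "linear (\<lambda>x. S x + T x)"
    using S T by (auto simp: order_bounded_operator_def intro: linear_compose_add)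
  obtain c d where 1: "\<And>x. a \<le> x \<Longrightarrow> x \<le> b \<Longrightarrow> c \<le> S x \<and> S x \<le> d"
    using order_bounded_operatorE[OF S] by blast
  obtain c' d' where 2: "\<And>x. a \<le> x \<Longrightarrow> x \<le> b \<Longrightarrow> c' \<le> T x \<and> T x \<le> d'"
    using order_bounded_operatorE[OF T] by blast
  show "\<exists>c d. \<forall>x. a \<le> x \<and> x \<le> b \<longrightarrow> c \<le> S x + T x \<and> S x + T x \<le> d"
    using 1 2 by (intro exI[of _ "c + c'"] exI[of _ "d + d'"]) (auto intro: add_mono)
qed

lift_definition uminus_ob_operator :: "('a, 'b) ob_operator \<Rightarrow> ('a, 'b) ob_operator"
  is "\<lambda>T x. - T x"
proof (rule order_bounded_operatorI)
  fix T :: "'a \<Rightarrow> 'b" and a b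
  assume T: "order_bounded_operator T"
  show "linear (\<lambda>x. - T x)"
    using T by (auto simp: order_bounded_operator_def intro: linear_compose_neg)
  obtain c d where "\<And>x. a \<le> x \<Longrightarrow> x \<le> b \<Longrightarrow> c \<le> T x \<and> T x \<le> d"
    using order_bounded_operatorE[OF T] by blast
  then show "\<exists>c d. \<forall>x. a \<le> x \<and> x \<le> b \<longrightarrow> c \<le> - T x \<and> - T x \<le> d"
    by (intro exI[of _ "- d"] exI[of _ "- c"]) auto
qed

definition minus_ob_operator ::
    "('a, 'b) ob_operator \<Rightarrow> ('a, 'b) ob_operator \<Rightarrow> ('a, 'b) ob_operator"
  where "S - T = S + - T" for S T :: "('a, 'b) ob_operator"

lift_definition scaleR_ob_operator :: "real \<Rightarrow> ('a, 'b) ob_operator \<Rightarrow> ('a, 'b) ob_operator"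
  is "\<lambda>r T x. r *\<^sub>R T x"
proof (rule order_bounded_operatorI)
  fix T :: "'a \<Rightarrow> 'b" and r :: real and a b
  assume T: "order_bounded_operator T"
  show "linear (\<lambda>x. r *\<^sub>R T x)"
    using T by (auto simp: order_bounded_operator_def intro: linear_compose_scale_right)
  obtain c d where cd: "\<And>x. a \<le> x \<Longrightarrow> x \<le> b \<Longrightarrow> c \<le> T x \<and> T x \<le> d"
    using order_bounded_operatorE[OF T] by blast
  show "\<exists>c d. \<forall>x. a \<le> x \<and> x \<le> b \<longrightarrow> c \<le> r *\<^sub>R T x \<and> r *\<^sub>R T x \<le> d"
  proof (cases "0 \<le> r")
    case True
    with cd show ?thesis
      by (intro exI[of _ "r *\<^sub>R c"] exI[of _ "r *\<^sub>R d"]) (auto intro: scaleR_left_mono)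
  next
    case False
    with cd show ?thesis
      by (intro exI[of _ "r *\<^sub>R d"] exI[of _ "r *\<^sub>R c"]) (auto intro: scaleR_left_mono_neg)
  qed
qed

instance
proof
  note [simp] = zero_ob_operator.rep_eq plus_ob_operator.rep_eq uminus_ob_operator.rep_eq
    scaleR_ob_operator.rep_eq
  fix S T U :: "('a, 'b) ob_operator" and r q :: real
  show "S + T + U = S + (T + U)" by (rule ob_operator_cone_eqI) (simp add: add.assoc)
  show "S + T = T + S" by (rule ob_operator_cone_eqI) (simp add: add.commute)
  show "0 + S = S" by (rule ob_operator_cone_eqI) simp
  show "- S + S = 0" by (rule ob_operator_cone_eqI) simp
  show "S - T = S + - T" by (rule minus_ob_operator_def)
  show "r *\<^sub>R (S + T) = r *\<^sub>R S + r *\<^sub>R T"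
    by (rule ob_operator_cone_eqI) (simp add: scaleR_add_right)
  show "(r + q) *\<^sub>R S = r *\<^sub>R S + q *\<^sub>R S"
    by (rule ob_operator_cone_eqI) (simp add: scaleR_add_left)
  show "r *\<^sub>R q *\<^sub>R S = (r * q) *\<^sub>R S" by (rule ob_operator_cone_eqI) simp
  show "1 *\<^sub>R S = S" by (rule ob_operator_cone_eqI) simp
qed

end

lemma ob_apply_simps [simp]:
  "ob_apply 0 x = 0"
  "ob_apply (S + T) x = ob_apply S x + ob_apply T x"
  "ob_apply (- T) x = - ob_apply T x"
  "ob_apply (S - T) x = ob_apply S x - ob_apply T x"
  "ob_apply (r *\<^sub>R T) x = r *\<^sub>R ob_apply T x"
proof -
  show "ob_apply (S - T) x = ob_apply S x - ob_apply T x"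
    unfolding minus_ob_operator_def[of S T]
    by (simp add: plus_ob_operator.rep_eq uminus_ob_operator.rep_eq del: add_uminus_conv_diff)
qed (simp_all add: zero_ob_operator.rep_eq plus_ob_operator.rep_eq uminus_ob_operator.rep_eq
      scaleR_ob_operator.rep_eq)

instantiation ob_operator :: (riesz_space, riesz_space) order
begin

definition less_eq_ob_operator :: "('a, 'b) ob_operator \<Rightarrow> ('a, 'b) ob_operator \<Rightarrow> bool"
  where "S \<le> T \<longleftrightarrow> (\<forall>u\<ge>0. ob_apply S u \<le> ob_apply T u)"

definition less_ob_operator :: "('a, 'b) ob_operator \<Rightarrow> ('a, 'b) ob_operator \<Rightarrow> bool"
  where "S < T \<longleftrightarrow> S \<le> T \<and> \<not> T \<le> S" for S T :: "('a, 'b) ob_operator"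

instance
proof
  fix S T U :: "('a, 'b) ob_operator"
  show "S \<le> S" by (simp add: less_eq_ob_operator_def)
  show "S \<le> T \<Longrightarrow> T \<le> U \<Longrightarrow> S \<le> U"
    unfolding less_eq_ob_operator_def by (meson order_trans)
  show "S \<le> T \<Longrightarrow> T \<le> S \<Longrightarrow> S = T"
    unfolding less_eq_ob_operator_def by (rule ob_operator_cone_eqI) (meson order_antisym)
qed (rule less_ob_operator_def)

end

instance ob_operator :: (riesz_space, riesz_space) ordered_real_vector
  by standard (auto simp: less_eq_ob_operator_def intro: scaleR_left_mono scaleR_right_mono)


subsection \<open>The lattice structure (Riesz--Kantorovich)\<close>

lemma cone_extension:
  fixes f :: "'a::riesz_space \<Rightarrow> 'b::riesz_space"
  assumes add: "\<And>x y. 0 \<le> x \<Longrightarrow> 0 \<le> y \<Longrightarrow> f (x + y) = f x + f y"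
    and scale: "\<And>c x. 0 \<le> c \<Longrightarrow> 0 \<le> x \<Longrightarrow> f (c *\<^sub>R x) = c *\<^sub>R f x"
  defines "g \<equiv> \<lambda>x. f (pprt x) - f (pprt (- x))"
  shows "linear g" and "\<And>x. 0 \<le> x \<Longrightarrow> g x = f x"
proof -
  have pp: "x = pprt x - pprt (- x)" for x :: 'a
    using prts[of x] by (simp add: pprt_neg)
  have key: "g x = f a - f b" if "x = a - b" "0 \<le> a" "0 \<le> b" for x a b
  proof -
    have "a + pprt (- x) = pprt x + b"
    proof -
      have "pprt x - pprt (- x) = a - b" using pp[of x] that(1) by simp
      then show ?thesis by (simp only: diff_eq_eq eq_diff_eq add_diff_eq diff_add_eq)
    qed
    then have "f a + f (pprt (- x)) = f (pprt x) + f b"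
      using that by (metis add zero_le_pprt)
    then show ?thesis by (simp add: g_def algebra_simps)
  qed
  have f0: "f 0 = 0" using scale[of 0 0] by simp
  show "g x = f x" if "0 \<le> x" for x
    using key[of x x 0] that f0 by simp
  show "linear g"
  proof (rule linearI)
    fix x y :: 'a
    have "x + y = (pprt x - pprt (- x)) + (pprt y - pprt (- y))"
      by (rule arg_cong2[where f = plus, OF pp pp])
    also have "\<dots> = (pprt x + pprt y) - (pprt (- x) + pprt (- y))" by (rule add_diff_add[symmetric])
    finally have "g (x + y) = f (pprt x + pprt y) - f (pprt (- x) + pprt (- y))"
      by (rule key) simp_all
    then show "g (x + y) = g x + g y" by (simp add: add g_def)
  next
    fix c :: real and x :: 'a
    have cx: "c *\<^sub>R x = c *\<^sub>R pprt x - c *\<^sub>R pprt (- x)"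
      unfolding scaleR_diff_right[symmetric] by (rule arg_cong[OF pp])
    show "g (c *\<^sub>R x) = c *\<^sub>R g x"
    proof (cases "0 \<le> c")
      case True
      have "g (c *\<^sub>R x) = f (c *\<^sub>R pprt x) - f (c *\<^sub>R pprt (- x))"
        by (rule key[OF cx]) (rule scaleR_nonneg_nonneg[OF True zero_le_pprt])+
      also have "\<dots> = c *\<^sub>R f (pprt x) - c *\<^sub>R f (pprt (- x))"
        by (simp only: scale[OF True zero_le_pprt])
      finally show ?thesis by (simp only: g_def scaleR_diff_right)
    next
      case False
      then have c: "0 \<le> - c" by simp
      have "c *\<^sub>R x = (- c) *\<^sub>R pprt (- x) - (- c) *\<^sub>R pprt x"
        unfolding cx by (simp only: scaleR_minus_left minus_diff_minus minus_diff_eq)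
      then have "g (c *\<^sub>R x) = f ((- c) *\<^sub>R pprt (- x)) - f ((- c) *\<^sub>R pprt x)"
        by (rule key) (rule scaleR_nonneg_nonneg[OF c zero_le_pprt])+
      also have "\<dots> = (- c) *\<^sub>R f (pprt (- x)) - (- c) *\<^sub>R f (pprt x)"
        by (simp only: scale[OF c zero_le_pprt])
      also have "\<dots> = c *\<^sub>R g x"
        unfolding g_def by (simp only: scaleR_minus_left minus_diff_minus minus_diff_eq scaleR_diff_right)
      finally show ?thesis .
    qed
  qed
qed

definition rk_sup :: "('a::riesz_space \<Rightarrow> 'b::dedekind_complete_riesz_space) \<Rightarrow> 'a \<Rightarrow> 'b"
  where "rk_sup T x = Sup (T ` {0..x})"

lemma rk_sup_upper:
  assumes "order_bounded_operator T" "0 \<le> y" "y \<le> x"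
  shows "T y \<le> rk_sup T x"
proof -
  obtain c d where "\<And>y. 0 \<le> y \<Longrightarrow> y \<le> x \<Longrightarrow> c \<le> T y \<and> T y \<le> d"
    using order_bounded_operatorE[OF assms(1), of 0 x] by blast
  then have "bdd_above (T ` {0..x})" by (intro bdd_aboveI[of _ d]) auto
  then show ?thesis unfolding rk_sup_def using assms(2,3) by (intro cSup_upper) auto
qed

lemma rk_sup_least:
  assumes "0 \<le> x" "\<And>y. 0 \<le> y \<Longrightarrow> y \<le> x \<Longrightarrow> T y \<le> z"
  shows "rk_sup T x \<le> z"
  unfolding rk_sup_def using assms by (intro cSup_least) auto

lemma rk_sup_add:
  assumes T: "order_bounded_operator T" and x: "0 \<le> x" and y: "0 \<le> y"
  shows "rk_sup T (x + y) = rk_sup T x + rk_sup T y"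
proof (rule antisym)
  have lin: "linear T" using T by (simp add: order_bounded_operator_def)
  show "rk_sup T (x + y) \<le> rk_sup T x + rk_sup T y"
  proof (rule rk_sup_least)
    fix z assume z: "0 \<le> z" "z \<le> x + y"
    define u where "u = inf z x"
    have u: "0 \<le> u" "u \<le> x" "u \<le> z" using z x by (simp_all add: u_def)
    have "z - y \<le> u" using z y by (simp add: u_def algebra_simps)
    then have "z - u \<le> y" by (simp add: algebra_simps)
    then have "T u + T (z - u) \<le> rk_sup T x + rk_sup T y"
      using u by (intro add_mono rk_sup_upper[OF T]) simp_all
    then show "T z \<le> rk_sup T x + rk_sup T y" by (simp add: linear_diff[OF lin])
  qed (use x y in simp)
  have "rk_sup T x \<le> rk_sup T (x + y) - rk_sup T y"
  proof (rule rk_sup_least[OF x])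
    fix u assume u: "0 \<le> u" "u \<le> x"
    have "rk_sup T y \<le> rk_sup T (x + y) - T u"
    proof (rule rk_sup_least[OF y])
      fix v assume v: "0 \<le> v" "v \<le> y"
      have "T (u + v) \<le> rk_sup T (x + y)"
        using u v by (intro rk_sup_upper[OF T]) (simp_all add: add_mono)
      then show "T v \<le> rk_sup T (x + y) - T u"
        by (simp add: linear_add[OF lin] algebra_simps)
    qed
    then show "T u \<le> rk_sup T (x + y) - rk_sup T y" by (simp add: algebra_simps)
  qed
  then show "rk_sup T x + rk_sup T y \<le> rk_sup T (x + y)" by (simp add: algebra_simps)
qed

lemma rk_sup_scale:
  assumes T: "order_bounded_operator T" and c: "0 \<le> c" and x: "0 \<le> x"
  shows "rk_sup T (c *\<^sub>R x) = c *\<^sub>R rk_sup T x"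
proof (cases "c = 0")
  case True
  have "linear T" using T by (simp add: order_bounded_operator_def)
  then have "T 0 = 0" by (rule linear_0)
  then show ?thesis using True by (simp add: rk_sup_def)
next
  case False
  have lin: "linear T" using T by (simp add: order_bounded_operator_def)
  have le: "rk_sup T (c *\<^sub>R x) \<le> c *\<^sub>R rk_sup T x" if c: "0 < c" and x: "0 \<le> x" for c x
  proof (rule rk_sup_least)
    fix z assume z: "0 \<le> z" "z \<le> c *\<^sub>R x"
    have "inverse c *\<^sub>R z \<le> inverse c *\<^sub>R (c *\<^sub>R x)"
      using z c by (intro scaleR_left_mono) simp_all
    then have "T (inverse c *\<^sub>R z) \<le> rk_sup T x"
      using z c by (intro rk_sup_upper[OF T]) (simp_all add: scaleR_nonneg_nonneg)
    then have "c *\<^sub>R T (inverse c *\<^sub>R z) \<le> c *\<^sub>R rk_sup T x"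
      using c by (intro scaleR_left_mono) simp_all
    then show "T z \<le> c *\<^sub>R rk_sup T x" using c by (simp add: linear_scale[OF lin])
  qed (use c x in \<open>simp add: scaleR_nonneg_nonneg\<close>)
  from False c have c: "0 < c" by simp
  have "rk_sup T (inverse c *\<^sub>R (c *\<^sub>R x)) \<le> inverse c *\<^sub>R rk_sup T (c *\<^sub>R x)"
    using c x by (intro le) (simp_all add: scaleR_nonneg_nonneg)
  then have "c *\<^sub>R rk_sup T x \<le> c *\<^sub>R (inverse c *\<^sub>R rk_sup T (c *\<^sub>R x))"
    using c by (intro scaleR_left_mono) simp_all
  with le[OF c x] c show ?thesis by (intro antisym) simp_all
qed

lemma ob_operator_pos_part_exists:
  fixes T :: "('a::riesz_space, 'b::dedekind_complete_riesz_space) ob_operator"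
  shows "\<exists>P. 0 \<le> P \<and> T \<le> P \<and> (\<forall>U. 0 \<le> U \<longrightarrow> T \<le> U \<longrightarrow> P \<le> U)"
proof -
  let ?f = "rk_sup (ob_apply T)"
  let ?g = "\<lambda>x. ?f (pprt x) - ?f (pprt (- x))"
  note ob = ob_operator_bounded[of T]
  have lin: "linear ?g" and ext: "\<And>x. 0 \<le> x \<Longrightarrow> ?g x = ?f x"
    using cone_extension[of ?f, OF rk_sup_add[OF ob] rk_sup_scale[OF ob]] by blast+
  have T0: "ob_apply T 0 = 0" by (rule linear_0[OF ob_operator_linear])
  have pos: "0 \<le> ?f x" if "0 \<le> x" for x
    using rk_sup_upper[OF ob, of 0 x] that T0 by simp
  have "order_bounded_operator ?g"
    by (rule order_bounded_operator_positive[OF lin]) (simp only: ext pos)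
  then have P: "ob_apply (Ob_operator ?g) = ?g" by (simp add: Ob_operator_inverse)
  have Pf: "ob_apply (Ob_operator ?g) x = ?f x" if "0 \<le> x" for x
    unfolding P using ext[OF that] .
  show ?thesis
  proof (intro exI[of _ "Ob_operator ?g"] conjI allI impI)
    show "0 \<le> Ob_operator ?g" by (simp add: less_eq_ob_operator_def Pf pos)
    show "T \<le> Ob_operator ?g" by (simp add: less_eq_ob_operator_def Pf rk_sup_upper[OF ob])
    fix U :: "('a, 'b) ob_operator" assume U: "0 \<le> U" "T \<le> U"
    have "?f x \<le> ob_apply U x" if x: "0 \<le> x" for x
    proof (rule rk_sup_least[OF x])
      fix y assume y: "0 \<le> y" "y \<le> x"
      have "ob_apply T y \<le> ob_apply U y" using U y by (simp add: less_eq_ob_operator_def)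
      also have "0 \<le> ob_apply U (x - y)" using U y by (simp add: less_eq_ob_operator_def)
      then have "ob_apply U y \<le> ob_apply U x"
        by (simp add: linear_diff[OF ob_operator_linear])
      finally show "ob_apply T y \<le> ob_apply U x" .
    qed
    then show "Ob_operator ?g \<le> U" by (simp add: less_eq_ob_operator_def Pf)
  qed
qed

lemma ob_operator_sup_exists:
  fixes S T :: "('a::riesz_space, 'b::dedekind_complete_riesz_space) ob_operator"
  shows "\<exists>P. S \<le> P \<and> T \<le> P \<and> (\<forall>U. S \<le> U \<longrightarrow> T \<le> U \<longrightarrow> P \<le> U)"
proof -
  obtain P where P: "0 \<le> P" "S - T \<le> P" "\<And>U. 0 \<le> U \<Longrightarrow> S - T \<le> U \<Longrightarrow> P \<le> U"
    using ob_operator_pos_part_exists[of "S - T"] by blast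
  show ?thesis
  proof (intro exI[of _ "P + T"] conjI allI impI)
    show "S \<le> P + T" using P(2) by (simp add: diff_le_eq)
    show "T \<le> P + T" using P(1) by simp
    show "P + T \<le> U" if "S \<le> U" "T \<le> U" for U
      using P(3)[of "U - T"] that by (simp add: le_diff_eq)
  qed
qed

instantiation ob_operator :: (riesz_space, dedekind_complete_riesz_space) lattice_ab_group_add_abs
begin

definition sup_ob_operator ::
    "('a, 'b) ob_operator \<Rightarrow> ('a, 'b) ob_operator \<Rightarrow> ('a, 'b) ob_operator"
  where "sup S T = (THE P. S \<le> P \<and> T \<le> P \<and> (\<forall>U. S \<le> U \<longrightarrow> T \<le> U \<longrightarrow> P \<le> U))"
    for S T :: "('a, 'b) ob_operator"

definition inf_ob_operator ::
    "('a, 'b) ob_operator \<Rightarrow> ('a, 'b) ob_operator \<Rightarrow> ('a, 'b) ob_operator"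
  where "inf S T = - sup (- S) (- T)" for S T :: "('a, 'b) ob_operator"

definition abs_ob_operator :: "('a, 'b) ob_operator \<Rightarrow> ('a, 'b) ob_operator"
  where "\<bar>T\<bar> = sup T (- T)" for T :: "('a, 'b) ob_operator"

instance
proof
  have sup: "S \<le> sup S T \<and> T \<le> sup S T \<and> (\<forall>U. S \<le> U \<longrightarrow> T \<le> U \<longrightarrow> sup S T \<le> U)"
    for S T :: "('a, 'b) ob_operator"
  proof -
    obtain P where P: "S \<le> P \<and> T \<le> P \<and> (\<forall>U. S \<le> U \<longrightarrow> T \<le> U \<longrightarrow> P \<le> U)"
      using ob_operator_sup_exists[of S T] by blast
    show ?thesis
      unfolding sup_ob_operator_def
      by (rule theI[where a = P and P = "\<lambda>P. S \<le> P \<and> T \<le> P \<and> (\<forall>U. S \<le> U \<longrightarrow> T \<le> U \<longrightarrow> P \<le> U)"])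
        (use P in \<open>blast intro: antisym\<close>)+
  qed
  fix S T U :: "('a, 'b) ob_operator"
  show "S \<le> sup S T" "T \<le> sup S T" using sup by auto
  show "T \<le> S \<Longrightarrow> U \<le> S \<Longrightarrow> sup T U \<le> S" using sup by blast
  have "- S \<le> sup (- S) (- T)" "- T \<le> sup (- S) (- T)" using sup by auto
  then show "inf S T \<le> S" "inf S T \<le> T"
    unfolding inf_ob_operator_def by (simp_all add: minus_le_iff)
  show "S \<le> T \<Longrightarrow> S \<le> U \<Longrightarrow> S \<le> inf T U"
    using sup[of "- T" "- U"] le_minus_iff[of S "sup (- T) (- U)"]
    unfolding inf_ob_operator_def by simp
  show "\<bar>S\<bar> = sup S (- S)" by (rule abs_ob_operator_def)
qed

end


section \<open>Statistical order convergence\<close>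

text \<open>
  Sequences are indexed by the positive integers: every index set below is contained in
  \<^term>\<open>{1::nat..}\<close>, so the value of a sequence at \<open>0\<close> plays no role.
\<close>

definition has_natural_density :: "nat set \<Rightarrow> real \<Rightarrow> bool"
  where "has_natural_density J d \<longleftrightarrow> (\<lambda>n. real (card {j\<in>J. j \<le> n}) / real n) \<longlonglongrightarrow> d"

definition stat_order_decreasing ::
    "(nat \<Rightarrow> ('a::riesz_space, 'b::dedekind_complete_riesz_space) ob_operator)
      \<Rightarrow> ('a, 'b) ob_operator \<Rightarrow> bool"
  where "stat_order_decreasing S S\<^sub>0 \<longleftrightarrow>
    (\<exists>J\<subseteq>{1..}. has_natural_density J 1 \<and>
      (\<forall>j\<in>J. \<forall>m\<in>J. j < m \<longrightarrow> S m \<le> S j) \<and> isGlb UNIV (S ` J) S\<^sub>0)"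

definition stat_order_convergent ::
    "(nat \<Rightarrow> ('a::riesz_space, 'b::dedekind_complete_riesz_space) ob_operator)
      \<Rightarrow> ('a, 'b) ob_operator \<Rightarrow> bool"
  where "stat_order_convergent R R\<^sub>0 \<longleftrightarrow>
    (\<exists>S J. stat_order_decreasing S 0 \<and> J \<subseteq> {1..} \<and> has_natural_density J 1 \<and>
      (\<forall>j\<in>J. \<bar>R j - R\<^sub>0\<bar> \<le> S j))"

end

theory Submission
  imports Defs "HOL-Library.Infinite_Set"
begin

text \<open>
  Fix witnesses for the two convergences: majorants \<open>S\<close> and \<open>T\<close> decreasing to \<open>0\<close> along \<open>A\<close>
  and \<open>B\<close>, dominating \<open>\<bar>R j - R\<^sub>1\<bar>\<close> and \<open>\<bar>R j - R\<^sub>2\<bar>\<close> for \<open>j\<close> in \<open>J\<close> and \<open>K\<close>. Sets of natural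
  density one are closed under finite intersection and are infinite
  (\<open>has_natural_density_one_Int\<close>, \<open>has_natural_density_infinite\<close>), so arbitrarily late indices lie in
  all four sets at once. At such an index \<open>j\<close> the triangle inequality bounds
  \<open>D = \<bar>R\<^sub>1 - R\<^sub>2\<bar>\<close> by \<open>S j + T j\<close>, and by monotonicity this gives \<open>D \<le> S a + T b\<close> for every
  \<open>a\<close> in \<open>A\<close> and \<open>b\<close> in \<open>B\<close>. The two indices are now independent, so the infima can be taken
  one after the other (\<open>le_zero_if_le_add_Glb_zero\<close>), and \<open>D \<le> 0\<close>.
\<close>

lemma has_natural_density_infinite:
  assumes "has_natural_density J d" "d \<noteq> 0"
  shows "infinite J"
proof
  assume fin: "finite J"
  have "(\<lambda>n. real (card {j\<in>J. j \<le> n}) / real n) \<longlonglongrightarrow> 0"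
  proof (rule tendsto_sandwich[OF _ _ tendsto_const lim_const_over_n[of "real (card J)"]])
    show "\<forall>\<^sub>F n in sequentially. real (card {j\<in>J. j \<le> n}) / real n \<le> real (card J) / real n"
      using fin by (intro always_eventually allI divide_right_mono) (auto intro: card_mono)
  qed auto
  with assms show False
    unfolding has_natural_density_def using LIMSEQ_unique by blast
qed

text \<open>
  Inclusion--exclusion inside \<open>{..n}\<close>, which has \<open>n + 1\<close> elements: the intersection keeps at least
  \<open>\<alpha> + \<beta> - (n + 1)\<close> of them when the two sets keep \<open>\<alpha>\<close> and \<open>\<beta>\<close>.
\<close>

lemma has_natural_density_one_Int:
  assumes A: "has_natural_density A 1" and B: "has_natural_density B 1"
  shows "has_natural_density (A \<inter> B) 1"
proof -
  define c where "c J n = real (card {j\<in>J. j \<le> n})" for J and n :: nat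
  have lower: "c A n + c B n - (real n + 1) \<le> c (A \<inter> B) n" for n
  proof -
    let ?A = "{j\<in>A. j \<le> n}" and ?B = "{j\<in>B. j \<le> n}"
    have "card ?A + card ?B = card (?A \<union> ?B) + card (?A \<inter> ?B)"
      by (rule card_Un_Int) simp_all
    moreover have "card (?A \<union> ?B) \<le> card {..n}" by (rule card_mono) auto
    moreover have "?A \<inter> ?B = {j\<in>A \<inter> B. j \<le> n}" by auto
    ultimately show ?thesis unfolding c_def by simp
  qed
  have upper: "c (A \<inter> B) n \<le> c A n" for n
    unfolding c_def of_nat_le_iff by (rule card_mono) auto
  have limA: "(\<lambda>n. c A n / real n) \<longlonglongrightarrow> 1" and limB: "(\<lambda>n. c B n / real n) \<longlonglongrightarrow> 1"
    using A B by (simp_all add: has_natural_density_def c_def)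
  have "(\<lambda>n. c A n / real n + c B n / real n - (1 + 1 / real n)) \<longlonglongrightarrow> 1 + 1 - (1 + 0)"
    by (intro tendsto_intros limA limB lim_const_over_n)
  then have limL: "(\<lambda>n. c A n / real n + c B n / real n - (1 + 1 / real n)) \<longlonglongrightarrow> 1" by simp
  have "(\<lambda>n. c (A \<inter> B) n / real n) \<longlonglongrightarrow> 1"
  proof (rule tendsto_sandwich[OF _ _ limL limA])
    show "\<forall>\<^sub>F n in sequentially.
        c A n / real n + c B n / real n - (1 + 1 / real n) \<le> c (A \<inter> B) n / real n"
      using eventually_gt_at_top[of 0]
    proof eventually_elim
      case (elim n)
      have "c A n / real n + c B n / real n - (1 + 1 / real n) = (c A n + c B n - (real n + 1)) / real n"
        using elim by (simp add: field_simps)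
      also have "\<dots> \<le> c (A \<inter> B) n / real n" by (rule divide_right_mono[OF lower]) simp
      finally show ?case .
    qed
    show "\<forall>\<^sub>F n in sequentially. c (A \<inter> B) n / real n \<le> c A n / real n"
      by (intro always_eventually allI divide_right_mono upper) simp
  qed
  then show ?thesis by (simp add: has_natural_density_def c_def)
qed

lemma le_if_lower_bound_isGlb:
  assumes "isGlb UNIV X x" "\<And>y. y \<in> X \<Longrightarrow> z \<le> y"
  shows "z \<le> x"
  using assms unfolding isGlb_def greatestP_def isLb_def setge_def setle_def by auto

text \<open>
  For fixed \<open>y\<close> the element \<open>d - y\<close> is a lower bound of \<open>X\<close>, hence \<open>d \<le> y\<close>; so \<open>d\<close> is in turn a
  lower bound of \<open>Y\<close>.
\<close>

lemma le_zero_if_le_add_Glb_zero: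
  fixes d :: "'a::ordered_ab_group_add"
  assumes X: "isGlb UNIV X 0" and Y: "isGlb UNIV Y 0"
    and le: "\<And>x y. x \<in> X \<Longrightarrow> y \<in> Y \<Longrightarrow> d \<le> x + y"
  shows "d \<le> 0"
proof (rule le_if_lower_bound_isGlb[OF Y])
  fix y assume y: "y \<in> Y"
  have "d - y \<le> 0"
    by (rule le_if_lower_bound_isGlb[OF X]) (simp add: diff_le_eq le y)
  then show "d \<le> y" by simp
qed

theorem theorem3p9:
  fixes R :: "nat \<Rightarrow> ('a::riesz_space, 'b::dedekind_complete_riesz_space) ob_operator"
    and R\<^sub>1 R\<^sub>2 :: "('a, 'b) ob_operator"
  assumes "stat_order_convergent R R\<^sub>1"
    and "stat_order_convergent R R\<^sub>2"
  shows "R\<^sub>1 = R\<^sub>2"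
proof -
  from assms(1) obtain S J where S: "stat_order_decreasing S 0"
    and J: "has_natural_density J 1" and SR: "\<And>j. j \<in> J \<Longrightarrow> \<bar>R j - R\<^sub>1\<bar> \<le> S j"
    unfolding stat_order_convergent_def by metis
  from S obtain A where A: "has_natural_density A 1"
    and Sdec: "\<And>j m. j \<in> A \<Longrightarrow> m \<in> A \<Longrightarrow> j < m \<Longrightarrow> S m \<le> S j"
    and Sinf: "isGlb UNIV (S ` A) 0"
    unfolding stat_order_decreasing_def by metis
  from assms(2) obtain T K where T: "stat_order_decreasing T 0"
    and K: "has_natural_density K 1" and TR: "\<And>j. j \<in> K \<Longrightarrow> \<bar>R j - R\<^sub>2\<bar> \<le> T j"
    unfolding stat_order_convergent_def by metis
  from T obtain B where B: "has_natural_density B 1"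
    and Tdec: "\<And>j m. j \<in> B \<Longrightarrow> m \<in> B \<Longrightarrow> j < m \<Longrightarrow> T m \<le> T j"
    and Tinf: "isGlb UNIV (T ` B) 0"
    unfolding stat_order_decreasing_def by metis
  have inf: "infinite ((A \<inter> J) \<inter> (B \<inter> K))"
    using A J B K by (intro has_natural_density_infinite[of _ 1] has_natural_density_one_Int) simp_all
  have le: "\<bar>R\<^sub>1 - R\<^sub>2\<bar> \<le> S a + T b" if a: "a \<in> A" and b: "b \<in> B" for a b
  proof -
    obtain j where j: "max a b < j" "j \<in> A" "j \<in> J" "j \<in> B" "j \<in> K"
      using inf unfolding infinite_nat_iff_unbounded by blast
    have "\<bar>R\<^sub>1 - R\<^sub>2\<bar> = \<bar>(R j - R\<^sub>2) - (R j - R\<^sub>1)\<bar>" by simp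
    also have "\<dots> \<le> \<bar>R j - R\<^sub>2\<bar> + \<bar>R j - R\<^sub>1\<bar>" by (rule abs_triangle_ineq4)
    also have "\<dots> \<le> T j + S j" using j by (intro add_mono TR SR)
    also have "\<dots> \<le> T b + S a" using j a b by (intro add_mono Tdec Sdec) simp_all
    finally show ?thesis by (simp add: add.commute)
  qed
  have "\<bar>R\<^sub>1 - R\<^sub>2\<bar> \<le> 0"
    by (rule le_zero_if_le_add_Glb_zero[OF Sinf Tinf]) (auto intro: le)
  then show ?thesis by simp
qed

end
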